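(* Let $\psi$ be a QCBF instance and let $(\phi,\mathbf{B})$ be a QCSP translation of $\psi$ (with $I_\phi=I_\psi$). For each constraint judgement proof of $(\phi,\mathbf{B})$ of length $s$ and width $w$, there exists a clause judgement proof of $\psi$ of length at most $s\cdot\max(w2^{w-1},1)$ and width at most $w$ such that for each constraint judgement $(i,V,F)$ appearing in the first proof and each map $g:V\to\{0,1\}$ with $g\notin F$, there is a clause judgement $(i,\alpha)$ in the second proof with $\mathrm{vars}(\alpha)\subseteq V$ such that $g$ does not satisfy $\alpha$.
   Context: Propositional side. A literal is a variable $v$ or its negation $\overline{v}$; $v,\overline{v}$ are complementary. A clause is a disjunction of literals with at most one literal on each variable (also a set of literals); $\mathrm{vars}(\alpha)$ is its set of variables. $\gamma$ is a resolvent of $\alpha,\beta$ if there is $L\in\alpha$ with complement $M\in\beta$ and $\gamma=(\alpha\setminus\{L\})\cup(\beta\setminus\{M\})$ is a clause. A QCBF instance is a propositional formula without free variables built from clauses, conjunction and $\forall/\exists$ quantification; $I_\psi$ has one index per subformula occurrence (a clause has no proper subformulas), $\psi(i)$ is the subformula at $i$, parent/child refer to the syntax tree. A clause judgement is $(i,\alpha)$ with $\mathrm{vars}(\alpha)\subseteq\mathrm{free}(\psi(i))$; its width is $|\mathrm{vars}(\alpha)|$. A clause judgement proof is a finite sequence of clause judgements each of one of the types: (clause) $(i,\alpha)$ with $\psi(i)$ the clause $\alpha$; (resolve) $(i,\gamma)$ from previous $(i,\alpha),(i,\beta)$ with $\gamma$ a resolvent of $\alpha,\beta$; (upward flow) $(i,\alpha)$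 from previous $(j,\alpha)$, $i$ the parent of $j$; ($\forall$-removal) $(i,\alpha\setminus\{y,\overline{y}\})$ from previous $(j,\alpha)$ with $\psi(i)=\forall y\,\psi(j)$, $i$ parent of $j$; (downward flow) $(j,\alpha)$ from previous $(i,\alpha)$, $i$ parent of $j$. QCSP side. A qc-formula is built from relational atoms, conjunction, $\forall,\exists$; $I_\phi$, $\phi(i)$, parent/child as for syntax trees. A constraint judgement is $(i,V,F)$ with $V\subseteq\mathrm{free}(\phi(i))$ and $F$ a set of maps $V\to B$; width $|V|$. With $F_1\Join F_2=\{f:U_1\cup U_2\to B: f\upharpoonright U_1\in F_1, f\upharpoonright U_2\in F_2\}$ and, for $y\in U$, $\epsilon_yF=\{f:U\setminus\{y\}\to B: f[y\to b]\in F$ for all $b\}$, a constraint judgement proof is a finite sequence of constraint judgements each of type: (atom) $(i,\{v_1,\dots,v_k\},F)$, $\phi(i)=R(v_1,\dots,v_k)$, $F=\{f:(f(v_1),\dots,f(v_k))\in R^{\mathbf{B}}\}$; (projection) $(i,U,F\upharpoonright U)$ from previous $(i,V,F)$, $U\subseteq V$; (join) $(i,U_1\cup U_2,F_1\Join F_2)$ from previous $(i,U_1,F_1),(i,U_2,F_2)$; (upward flow) $(i,V,F)$ from previous $(j,V,F)$, $i$ parent of $j$; ($\forall$-elimination) $(i,V\setminus\{y\},\epsilon_yF)$ from previous $(j,V,F)$, $y\in V$, $\phi(i)=\forall y\,\phi(j)$, $i$ parent of $j$; (downward flow) $(j,V,F)$ from previous $(i,V,F)$, $i$ parent of $j$.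 For both kinds of proofs, length is the number of judgements and width is the maximum width of its judgements. A QCSP translation of $\psi$ is $(\phi,\mathbf{B})$ with $\mathbf{B}$ one-sorted with universe $\{0,1\}$ and $\phi$ obtained from $\psi$ by replacing each clause $\gamma$ with variables $v_1,\dots,v_k$ by an atom $R(v_1,\dots,v_k)$ with $R^{\mathbf{B}}=\{(f(v_1),\dots,f(v_k)) : f \text{ satisfies } \gamma\}$; corresponding subformulas of $\phi$ and $\psi$ share indices. *)

theory Defs
  imports Main "HOL-Library.FuncSet"
begin

text \<open>Quantified conjunctions over arbitrary leaves; the leaves are clauses for QCBF and
  relational atoms for qc-formulas. Sharing the type makes indices of an instance and of its
  translation directly comparable.\<close>

datatype ('a, 'v) qconj =
    Leaf 'a
  | Conj "('a, 'v) qconj" "('a, 'v) qconj"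
  | Forall 'v "('a, 'v) qconj"
  | Exists 'v "('a, 'v) qconj"

fun children :: "('a, 'v) qconj \<Rightarrow> ('a, 'v) qconj list" where
  "children (Leaf a) = []"
| "children (Conj p q) = [p, q]"
| "children (Forall y p) = [p]"
| "children (Exists y p) = [p]"

text \<open>An index is a path from the root of the syntax tree, so that distinct occurrences of the
  same subformula have distinct indices.\<close>

type_synonym index = "nat list"

fun subformula :: "('a, 'v) qconj \<Rightarrow> index \<Rightarrow> ('a, 'v) qconj option" where
  "subformula p [] = Some p"
| "subformula p (n # i) =
     (if n < length (children p) then subformula (children p ! n) i else None)"

definition indices :: "('a, 'v) qconj \<Rightarrow> index set" where
  "indices p = {i. subformula p i \<noteq> None}"

definition parent :: "('a, 'v) qconj \<Rightarrow> index \<Rightarrow> index \<Rightarrow> bool" where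
  "parent p i j \<longleftrightarrow> j \<in> indices p \<and> (\<exists>n. j = i @ [n])"

fun free :: "('a \<Rightarrow> 'v set) \<Rightarrow> ('a, 'v) qconj \<Rightarrow> 'v set" where
  "free lv (Leaf a) = lv a"
| "free lv (Conj p q) = free lv p \<union> free lv q"
| "free lv (Forall y p) = free lv p - {y}"
| "free lv (Exists y p) = free lv p - {y}"

datatype 'v literal = Pos (var: 'v) | Neg (var: 'v)

fun complement :: "'v literal \<Rightarrow> 'v literal" where
  "complement (Pos v) = Neg v"
| "complement (Neg v) = Pos v"

definition vars :: "'v literal set \<Rightarrow> 'v set" where
  "vars \<alpha> = var ` \<alpha>"

definition is_clause :: "'v literal set \<Rightarrow> bool" where
  "is_clause \<alpha> \<longleftrightarrow> finite \<alpha> \<and> (\<forall>v. \<not> (Pos v \<in> \<alpha> \<and> Neg v \<in> \<alpha>))"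

text \<open>The truth values 0 and 1 are \<^const>\<open>False\<close> and \<^const>\<open>True\<close>.\<close>

fun lit_true :: "('v \<Rightarrow> bool) \<Rightarrow> 'v literal \<Rightarrow> bool" where
  "lit_true f (Pos v) \<longleftrightarrow> f v"
| "lit_true f (Neg v) \<longleftrightarrow> \<not> f v"

definition satisfies :: "('v \<Rightarrow> bool) \<Rightarrow> 'v literal set \<Rightarrow> bool" where
  "satisfies f \<alpha> \<longleftrightarrow> (\<exists>L\<in>\<alpha>. lit_true f L)"

definition resolvent :: "'v literal set \<Rightarrow> 'v literal set \<Rightarrow> 'v literal set \<Rightarrow> bool" where
  "resolvent \<gamma> \<alpha> \<beta> \<longleftrightarrow>
     (\<exists>L\<in>\<alpha>. complement L \<in> \<beta> \<and> \<gamma> = (\<alpha> - {L}) \<union> (\<beta> - {complement L}) \<and> is_clause \<gamma>)"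

type_synonym 'v qcbf = "('v literal set, 'v) qconj"

definition qcbf_instance :: "'v qcbf \<Rightarrow> bool" where
  "qcbf_instance \<psi> \<longleftrightarrow>
     (\<forall>i \<alpha>. subformula \<psi> i = Some (Leaf \<alpha>) \<longrightarrow> is_clause \<alpha>) \<and> free vars \<psi> = {}"

type_synonym 'v clause_judgement = "index \<times> 'v literal set"

definition is_clause_judgement :: "'v qcbf \<Rightarrow> 'v clause_judgement \<Rightarrow> bool" where
  "is_clause_judgement \<psi> = (\<lambda>(i, \<alpha>).
     is_clause \<alpha> \<and> (\<exists>p. subformula \<psi> i = Some p \<and> vars \<alpha> \<subseteq> free vars p))"

text \<open>The set \<open>P\<close> holds the previously derived judgements.\<close>

inductive clause_step :: "'v qcbf \<Rightarrow> 'v clause_judgement set \<Rightarrow> 'v clause_judgement \<Rightarrow> bool"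
  for \<psi> P where
  clause: "subformula \<psi> i = Some (Leaf \<alpha>) \<Longrightarrow> clause_step \<psi> P (i, \<alpha>)"
| resolve: "(i, \<alpha>) \<in> P \<Longrightarrow> (i, \<beta>) \<in> P \<Longrightarrow> resolvent \<gamma> \<alpha> \<beta> \<Longrightarrow> clause_step \<psi> P (i, \<gamma>)"
| upward_flow: "(j, \<alpha>) \<in> P \<Longrightarrow> parent \<psi> i j \<Longrightarrow> clause_step \<psi> P (i, \<alpha>)"
| forall_removal: "(j, \<alpha>) \<in> P \<Longrightarrow> parent \<psi> i j \<Longrightarrow>
    subformula \<psi> j = Some p \<Longrightarrow> subformula \<psi> i = Some (Forall y p) \<Longrightarrow>
    clause_step \<psi> P (i, \<alpha> - {Pos y, Neg y})"
| downward_flow: "(i, \<alpha>) \<in> P \<Longrightarrow> parent \<psi> i j \<Longrightarrow> clause_step \<psi> P (j, \<alpha>)"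

definition clause_judgement_proof :: "'v qcbf \<Rightarrow> 'v clause_judgement list \<Rightarrow> bool" where
  "clause_judgement_proof \<psi> \<rho> \<longleftrightarrow>
     (\<forall>k < length \<rho>. is_clause_judgement \<psi> (\<rho> ! k) \<and> clause_step \<psi> (set (take k \<rho>)) (\<rho> ! k))"

text \<open>The inserted 0 only serves to give the empty proof width 0.\<close>

definition clause_proof_width :: "'v clause_judgement list \<Rightarrow> nat" where
  "clause_proof_width \<rho> = Max (insert 0 ((\<lambda>(i, \<alpha>). card (vars \<alpha>)) ` set \<rho>))"

text \<open>A map from \<open>V\<close> to the universe is an element of the extensional function space
  \<open>V \<rightarrow>\<^sub>E universe B\<close>.\<close>

record ('r, 'b) relstruct =
  universe :: "'b set"
  arity :: "'r \<Rightarrow> nat"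
  interp :: "'r \<Rightarrow> 'b list set"

definition is_structure :: "('r, 'b) relstruct \<Rightarrow> bool" where
  "is_structure B \<longleftrightarrow> universe B \<noteq> {} \<and>
     (\<forall>R. interp B R \<subseteq> {t. length t = arity B R \<and> set t \<subseteq> universe B})"

datatype ('r, 'v) atom = Atom (symbol: 'r) (args: "'v list")

type_synonym ('r, 'v) qc_formula = "(('r, 'v) atom, 'v) qconj"

definition atom_vars :: "('r, 'v) atom \<Rightarrow> 'v set" where
  "atom_vars a = set (args a)"

definition qcsp_instance :: "('r, 'v) qc_formula \<Rightarrow> ('r, 'b) relstruct \<Rightarrow> bool" where
  "qcsp_instance \<phi> B \<longleftrightarrow> is_structure B \<and>
     (\<forall>i R vs. subformula \<phi> i = Some (Leaf (Atom R vs)) \<longrightarrow> length vs = arity B R) \<and>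
     free atom_vars \<phi> = {}"

type_synonym ('v, 'b) constraint_judgement = "index \<times> 'v set \<times> ('v \<Rightarrow> 'b) set"

definition is_constraint_judgement ::
  "('r, 'v) qc_formula \<Rightarrow> ('r, 'b) relstruct \<Rightarrow> ('v, 'b) constraint_judgement \<Rightarrow> bool" where
  "is_constraint_judgement \<phi> B = (\<lambda>(i, V, F).
     (\<exists>p. subformula \<phi> i = Some p \<and> V \<subseteq> free atom_vars p) \<and> F \<subseteq> V \<rightarrow>\<^sub>E universe B)"

definition proj :: "'v set \<Rightarrow> ('v \<Rightarrow> 'b) set \<Rightarrow> ('v \<Rightarrow> 'b) set" where
  "proj U F = (\<lambda>f. restrict f U) ` F"

definition join ::
  "'b set \<Rightarrow> 'v set \<Rightarrow> ('v \<Rightarrow> 'b) set \<Rightarrow> 'v set \<Rightarrow> ('v \<Rightarrow> 'b) set \<Rightarrow> ('v \<Rightarrow> 'b) set" where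
  "join D U1 F1 U2 F2 =
     {f \<in> (U1 \<union> U2) \<rightarrow>\<^sub>E D. restrict f U1 \<in> F1 \<and> restrict f U2 \<in> F2}"

definition forall_elim ::
  "'b set \<Rightarrow> 'v set \<Rightarrow> 'v \<Rightarrow> ('v \<Rightarrow> 'b) set \<Rightarrow> ('v \<Rightarrow> 'b) set" where
  "forall_elim D U y F = {f \<in> (U - {y}) \<rightarrow>\<^sub>E D. \<forall>b\<in>D. f(y := b) \<in> F}"

inductive constraint_step ::
  "('r, 'v) qc_formula \<Rightarrow> ('r, 'b) relstruct \<Rightarrow> ('v, 'b) constraint_judgement set \<Rightarrow>
   ('v, 'b) constraint_judgement \<Rightarrow> bool"
  for \<phi> B P where
  atom: "subformula \<phi> i = Some (Leaf (Atom R vs)) \<Longrightarrow>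
    constraint_step \<phi> B P (i, set vs, {f \<in> set vs \<rightarrow>\<^sub>E universe B. map f vs \<in> interp B R})"
| projection: "(i, V, F) \<in> P \<Longrightarrow> U \<subseteq> V \<Longrightarrow> constraint_step \<phi> B P (i, U, proj U F)"
| join: "(i, U1, F1) \<in> P \<Longrightarrow> (i, U2, F2) \<in> P \<Longrightarrow>
    constraint_step \<phi> B P (i, U1 \<union> U2, join (universe B) U1 F1 U2 F2)"
| upward_flow: "(j, V, F) \<in> P \<Longrightarrow> parent \<phi> i j \<Longrightarrow> constraint_step \<phi> B P (i, V, F)"
| forall_elimination: "(j, V, F) \<in> P \<Longrightarrow> y \<in> V \<Longrightarrow> parent \<phi> i j \<Longrightarrow>
    subformula \<phi> j = Some p \<Longrightarrow> subformula \<phi> i = Some (Forall y p) \<Longrightarrow>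
    constraint_step \<phi> B P (i, V - {y}, forall_elim (universe B) V y F)"
| downward_flow: "(i, V, F) \<in> P \<Longrightarrow> parent \<phi> i j \<Longrightarrow> constraint_step \<phi> B P (j, V, F)"

definition constraint_judgement_proof ::
  "('r, 'v) qc_formula \<Rightarrow> ('r, 'b) relstruct \<Rightarrow> ('v, 'b) constraint_judgement list \<Rightarrow> bool" where
  "constraint_judgement_proof \<phi> B \<pi> \<longleftrightarrow>
     (\<forall>k < length \<pi>. is_constraint_judgement \<phi> B (\<pi> ! k) \<and>
        constraint_step \<phi> B (set (take k \<pi>)) (\<pi> ! k))"

definition constraint_proof_width :: "('v, 'b) constraint_judgement list \<Rightarrow> nat" where
  "constraint_proof_width \<pi> = Max (insert 0 ((\<lambda>(i, V, F). card V) ` set \<pi>))"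

definition translates_clause ::
  "('r, bool) relstruct \<Rightarrow> 'v literal set \<Rightarrow> ('r, 'v) atom \<Rightarrow> bool" where
  "translates_clause B \<gamma> a \<longleftrightarrow> distinct (args a) \<and> set (args a) = vars \<gamma> \<and>
     interp B (symbol a) =
       {map f (args a) | f. f \<in> vars \<gamma> \<rightarrow>\<^sub>E {False, True} \<and> satisfies f \<gamma>}"

text \<open>The relator relates exactly the formulas of the same shape with the same quantified
  variables whose corresponding leaves are related.\<close>

definition qcsp_translation ::
  "'v qcbf \<Rightarrow> ('r, 'v) qc_formula \<Rightarrow> ('r, bool) relstruct \<Rightarrow> bool" where
  "qcsp_translation \<psi> \<phi> B \<longleftrightarrow> qcsp_instance \<phi> B \<and> universe B = {False, True} \<and>
     rel_qconj (translates_clause B) (=) \<psi> \<phi>"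

end

theory Submission imports Defs begin

text \<open>The constraint proof is simulated one judgement at a time: for each judgement \<open>(i, V, F)\<close>
  the clauses derived at \<open>i\<close> over \<open>V\<close> refute every assignment outside \<open>F\<close>. Projection and
  emptiness are handled by a full binary resolution tree over the eliminated variables.
  Flow steps would cost up to \<open>2 ^ w\<close> clauses, which exceeds the bound for \<open>w = 1\<close>; the invariant
  therefore also demands that the empty clause is present whenever \<open>F\<close> is empty, so that either
  one clause or at most \<open>2 ^ w - 1\<close> clauses have to be moved.\<close>

section \<open>Translations\<close>

text \<open>Related formulas have pairwise related lists of children, so relatedness survives each
  step down a path. The transfer goes from \<open>q\<close> to \<open>p\<close> because the
  constraint proof is given and the clause proof is to be built.\<close>

lemma translation_subformula:
  assumes "rel_qconj T (=) p q" "subformula q i = Some q'"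
  shows "\<exists>p'. subformula p i = Some p' \<and> rel_qconj T (=) p' q'"
  using assms
proof (induction i arbitrary: p q)
  case (Cons n i)
  have "list_all2 (rel_qconj T (=)) (children p) (children q)"
    using Cons.prems(1) by (cases rule: qconj.rel_cases) auto
  then show ?case
    using Cons by (auto simp: list_all2_conv_all_nth split: if_splits)
qed auto

lemma translation_subformula_None:
  assumes "rel_qconj T (=) p q"
  shows "subformula p i = None \<longleftrightarrow> subformula q i = None"
  using assms
proof (induction i arbitrary: p q)
  case (Cons n i)
  have "list_all2 (rel_qconj T (=)) (children p) (children q)"
    using Cons.prems(1) by (cases rule: qconj.rel_cases) auto
  then show ?case
    using Cons.IH by (auto simp: list_all2_conv_all_nth)
qed auto

lemma translation_parent:
  "rel_qconj T (=) p q \<Longrightarrow> parent p i j \<longleftrightarrow> parent q i j"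
  by (auto simp: parent_def indices_def translation_subformula_None)

lemma translation_free:
  assumes "rel_qconj (translates_clause B) (=) p q"
  shows "free vars p = free atom_vars q"
  using assms
  by (induction rule: qconj.rel_induct) (auto simp: translates_clause_def atom_vars_def)

text \<open>The variable set of a constraint judgement inherits finiteness from here; for an
  infinite set a bound on \<open>card\<close> would say nothing.\<close>

lemma finite_free_atom_vars: "finite (free atom_vars q)"
  by (induction q) (auto simp: atom_vars_def)

section \<open>Extending clause judgement proofs\<close>

lemma satisfies_cong:
  assumes "vars \<alpha> \<subseteq> V" "\<And>x. x \<in> V \<Longrightarrow> f x = g x"
  shows "satisfies f \<alpha> \<longleftrightarrow> satisfies g \<alpha>"
proof -
  have "lit_true f L \<longleftrightarrow> lit_true g L" if "L \<in> \<alpha>" for L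
    using that assms by (cases L) (force simp: vars_def)+
  then show ?thesis
    by (auto simp: satisfies_def)
qed

text \<open>A complementary pair is satisfied by every map, so a falsified set contains none. This
  makes the sets built by resolution legal clauses.\<close>

lemma is_clause_if_falsified: "finite \<alpha> \<Longrightarrow> \<not> satisfies g \<alpha> \<Longrightarrow> is_clause \<alpha>"
  unfolding is_clause_def satisfies_def by (metis lit_true.simps)

lemma not_lit_true_if_falsified_update:
  assumes "\<not> satisfies (g(x := b)) \<alpha>" "L \<in> \<alpha>" "var L \<noteq> x"
  shows "\<not> lit_true g L"
proof -
  have "\<not> lit_true (g(x := b)) L"
    using assms(1,2) by (auto simp: satisfies_def)
  then show ?thesis
    using assms(3) by (cases L) auto
qed

definition bounded_proof :: "'v qcbf \<Rightarrow> nat \<Rightarrow> 'v clause_judgement list \<Rightarrow> bool" where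
  "bounded_proof \<psi> w \<rho> \<longleftrightarrow>
     clause_judgement_proof \<psi> \<rho> \<and> (\<forall>(i, \<alpha>)\<in>set \<rho>. card (vars \<alpha>) \<le> w)"

text \<open>Only inclusion of the sets of judgements is recorded, not a prefix relation, since that
  is what keeps refutations alive; \<open>n\<close> is the number of judgements that may be
  spent.\<close>

definition extends ::
  "'v qcbf \<Rightarrow> nat \<Rightarrow> nat \<Rightarrow> 'v clause_judgement list \<Rightarrow> 'v clause_judgement list \<Rightarrow> bool" where
  "extends \<psi> w n \<rho> \<rho>' \<longleftrightarrow>
     bounded_proof \<psi> w \<rho>' \<and> set \<rho> \<subseteq> set \<rho>' \<and> length \<rho>' \<le> length \<rho> + n"

text \<open>Under this condition every clause over \<open>V\<close> may be placed at
  \<open>i\<close> without exceeding width \<open>w\<close>.\<close>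

definition admissible :: "'v qcbf \<Rightarrow> nat \<Rightarrow> index \<Rightarrow> 'v set \<Rightarrow> bool" where
  "admissible \<psi> w i V \<longleftrightarrow>
     finite V \<and> card V \<le> w \<and> (\<exists>p. subformula \<psi> i = Some p \<and> V \<subseteq> free vars p)"

definition refuted ::
  "'v clause_judgement set \<Rightarrow> index \<Rightarrow> 'v set \<Rightarrow> ('v \<Rightarrow> bool) \<Rightarrow> bool" where
  "refuted S i V g \<longleftrightarrow> (\<exists>\<alpha>. (i, \<alpha>) \<in> S \<and> vars \<alpha> \<subseteq> V \<and> \<not> satisfies g \<alpha>)"

lemma refuted_mono: "refuted S i V g \<Longrightarrow> S \<subseteq> T \<Longrightarrow> V \<subseteq> W \<Longrightarrow> refuted T i W g"
  by (auto simp: refuted_def)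

lemma refuted_cong:
  "(\<And>x. x \<in> V \<Longrightarrow> f x = g x) \<Longrightarrow> refuted S i V f \<longleftrightarrow> refuted S i V g"
  unfolding refuted_def using satisfies_cong by blast

text \<open>Refutation over \<open>V\<close> depends only on the values on \<open>V\<close>. Hence
  the finitely many extensional maps can be treated one by one and the result holds for all total
  maps.\<close>

lemma refuted_if_restrict_refuted:
  assumes "\<forall>g\<in>(V \<rightarrow>\<^sub>E UNIV) - F. refuted S i V g" "restrict g V \<notin> F"
  shows "refuted S i V g"
proof -
  have "refuted S i V (restrict g V)"
    using assms by simp
  then show ?thesis
    using refuted_cong[of V "restrict g V" g] by simp
qed

text \<open>The only literal set without variables is empty, and no map satisfies it.\<close>

lemma refuted_empty: "refuted S i {} g \<longleftrightarrow> (i, {}) \<in> S"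
  by (auto simp: refuted_def vars_def satisfies_def)

lemma bounded_proof_clause: "bounded_proof \<psi> w \<rho> \<Longrightarrow> (i, \<alpha>) \<in> set \<rho> \<Longrightarrow> is_clause \<alpha>"
  by (fastforce simp: bounded_proof_def clause_judgement_proof_def is_clause_judgement_def
      in_set_conv_nth)

lemma extends_refl: "bounded_proof \<psi> w \<rho> \<Longrightarrow> extends \<psi> w n \<rho> \<rho>"
  by (simp add: extends_def)

lemma extends_trans:
  "extends \<psi> w m \<rho> \<rho>' \<Longrightarrow> extends \<psi> w n \<rho>' \<rho>'' \<Longrightarrow> m + n \<le> k \<Longrightarrow> extends \<psi> w k \<rho> \<rho>''"
  by (auto simp: extends_def)

lemma extends_mono: "extends \<psi> w m \<rho> \<rho>' \<Longrightarrow> m \<le> n \<Longrightarrow> extends \<psi> w n \<rho> \<rho>'"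
  by (auto simp: extends_def)

lemma extends_step:
  assumes "bounded_proof \<psi> w \<rho>" "clause_step \<psi> (set \<rho>) (i, \<alpha>)" "is_clause \<alpha>"
    "admissible \<psi> w i V" "vars \<alpha> \<subseteq> V"
  shows "extends \<psi> w 1 \<rho> (\<rho> @ [(i, \<alpha>)])"
proof -
  have "card (vars \<alpha>) \<le> w"
    using assms(4,5) card_mono order_trans unfolding admissible_def by blast
  moreover have "is_clause_judgement \<psi> (i, \<alpha>)"
    using assms(3-5) by (auto simp: is_clause_judgement_def admissible_def)
  ultimately show ?thesis
    using assms(1,2)
    by (auto simp: extends_def bounded_proof_def clause_judgement_proof_def nth_append less_Suc_eq)
qed

text \<open>The premise speaks of an arbitrary larger proof \<open>\<rho>'\<close>: when the turn of
  \<open>g\<close> comes, the proof has already grown by the clauses for other assignments.\<close>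

lemma extends_all:
  assumes "finite G" "bounded_proof \<psi> w \<rho>"
    and "\<And>g \<rho>'. g \<in> G \<Longrightarrow> bounded_proof \<psi> w \<rho>' \<Longrightarrow> set \<rho> \<subseteq> set \<rho>' \<Longrightarrow>
      \<exists>\<rho>''. extends \<psi> w n \<rho>' \<rho>'' \<and> refuted (set \<rho>'') i V g"
  shows "\<exists>\<rho>'. extends \<psi> w (card G * n) \<rho> \<rho>' \<and> (\<forall>g\<in>G. refuted (set \<rho>') i V g)"
  using assms(1,3)
proof (induction G)
  case empty
  then show ?case
    using extends_refl[OF assms(2)] by auto
next
  case (insert g G)
  then obtain \<rho>' where 1: "extends \<psi> w (card G * n) \<rho> \<rho>'" "\<forall>g\<in>G. refuted (set \<rho>') i V g"
    by blast
  then obtain \<rho>'' where 2: "extends \<psi> w n \<rho>' \<rho>''" "refuted (set \<rho>'') i V g"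
    using insert.prems[of g \<rho>'] by (auto simp: extends_def)
  have "extends \<psi> w (card (insert g G) * n) \<rho> \<rho>''"
    using extends_trans[OF 1(1) 2(1)] insert.hyps by simp
  moreover have "\<forall>g\<in>insert g G. refuted (set \<rho>'') i V g"
    using 1(2) 2 refuted_mono[of "set \<rho>'" i V _ "set \<rho>''" V] by (auto simp: extends_def)
  ultimately show ?case
    by blast
qed

section \<open>Eliminating variables by resolution\<close>

text \<open>The clause falsified with \<open>x\<close> true can mention \<open>x\<close> only as
  \<open>Neg x\<close>, the other one only as \<open>Pos x\<close>. If both literals occur, the
  resolvent on \<open>x\<close> is falsified by \<open>g\<close>; otherwise one of the two clauses
  avoids \<open>x\<close> and already refutes \<open>g\<close> over \<open>U\<close>.\<close>

lemma refuted_resolve: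
  assumes \<rho>: "bounded_proof \<psi> w \<rho>" and U: "admissible \<psi> w i U" and x: "x \<notin> U"
    and T: "refuted (set \<rho>) i (insert x U) (g(x := True))"
    and F: "refuted (set \<rho>) i (insert x U) (g(x := False))"
  shows "\<exists>\<rho>'. extends \<psi> w 1 \<rho> \<rho>' \<and> refuted (set \<rho>') i U g"
proof -
  obtain \<alpha> where \<alpha>: "(i, \<alpha>) \<in> set \<rho>" "vars \<alpha> \<subseteq> insert x U" "\<not> satisfies (g(x := True)) \<alpha>"
    using T by (auto simp: refuted_def)
  obtain \<beta> where \<beta>: "(i, \<beta>) \<in> set \<rho>" "vars \<beta> \<subseteq> insert x U" "\<not> satisfies (g(x := False)) \<beta>"
    using F by (auto simp: refuted_def)
  have *: "vars (\<alpha> - {Neg x}) \<subseteq> U \<and> \<not> satisfies g (\<alpha> - {Neg x})"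
  proof -
    have "var L \<in> U \<and> \<not> lit_true g L" if L: "L \<in> \<alpha>" "L \<noteq> Neg x" for L
    proof -
      have "\<not> lit_true (g(x := True)) L"
        using L(1) \<alpha>(3) by (auto simp: satisfies_def)
      \<comment> \<open>The only other literal on \<open>x\<close> is \<open>Pos x\<close>, which
        the updated map makes true.\<close>
      then have "var L \<noteq> x"
        using L(2) by (cases L) auto
      moreover have "var L \<in> insert x U"
        using L(1) \<alpha>(2) by (auto simp: vars_def)
      ultimately show ?thesis
        using not_lit_true_if_falsified_update[OF \<alpha>(3) L(1)] by blast
    qed
    then show ?thesis by (auto simp: vars_def satisfies_def)
  qed
  have **: "vars (\<beta> - {Pos x}) \<subseteq> U \<and> \<not> satisfies g (\<beta> - {Pos x})"
  proof -
    have "var L \<in> U \<and> \<not> lit_true g L" if L: "L \<in> \<beta>" "L \<noteq> Pos x" for L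
    proof -
      have "\<not> lit_true (g(x := False)) L"
        using L(1) \<beta>(3) by (auto simp: satisfies_def)
      then have "var L \<noteq> x"
        using L(2) by (cases L) auto
      moreover have "var L \<in> insert x U"
        using L(1) \<beta>(2) by (auto simp: vars_def)
      ultimately show ?thesis
        using not_lit_true_if_falsified_update[OF \<beta>(3) L(1)] by blast
    qed
    then show ?thesis by (auto simp: vars_def satisfies_def)
  qed
  show ?thesis
  proof (cases "Neg x \<in> \<alpha> \<and> Pos x \<in> \<beta>")
    case False
    then have "refuted (set \<rho>) i U g"
      using * ** \<alpha>(1) \<beta>(1) unfolding refuted_def by (metis Diff_empty Diff_insert0)
    then show ?thesis
      using extends_refl[OF \<rho>] by blast
  next
    case True
    let ?\<gamma> = "(\<alpha> - {Neg x}) \<union> (\<beta> - {Pos x})"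
    have \<gamma>: "vars ?\<gamma> \<subseteq> U" "\<not> satisfies g ?\<gamma>"
      using * ** by (auto simp: vars_def satisfies_def)
    have "finite ?\<gamma>"
      using bounded_proof_clause[OF \<rho>] \<alpha>(1) \<beta>(1) by (auto simp: is_clause_def)
    then have cl: "is_clause ?\<gamma>"
      by (rule is_clause_if_falsified[OF _ \<gamma>(2)])
    then have "resolvent ?\<gamma> \<alpha> \<beta>"
      using True unfolding resolvent_def by (intro bexI[of _ "Neg x"]) auto
    then have "extends \<psi> w 1 \<rho> (\<rho> @ [(i, ?\<gamma>)])"
      by (intro extends_step[OF \<rho> clause_step.resolve[OF \<alpha>(1) \<beta>(1)] cl U \<gamma>(1)])
    moreover have "refuted (set (\<rho> @ [(i, ?\<gamma>)])) i U g"
      using \<gamma> unfolding refuted_def by (intro exI[of _ ?\<gamma>]) simp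
    ultimately show ?thesis
      by blast
  qed
qed

lemma admissible_subset:
  assumes "admissible \<psi> w i V" "U \<subseteq> V"
  shows "admissible \<psi> w i U"
proof -
  have "card U \<le> card V" "finite U"
    using assms card_mono finite_subset unfolding admissible_def by blast+
  then show ?thesis
    using assms unfolding admissible_def by force
qed

text \<open>Branch on the values of the variables in \<open>W\<close>. The leaves are refuted by
  assumption, and each of the \<open>2 ^ card W - 1\<close> inner nodes costs at most one
  resolution. In the induction the branching variable moves from \<open>W\<close> to
  \<open>U\<close>.\<close>

lemma refuted_project:
  assumes "finite W" "U \<inter> W = {}" "bounded_proof \<psi> w \<rho>" "admissible \<psi> w i (U \<union> W)"
    and "\<And>h. (\<And>x. x \<in> U \<Longrightarrow> h x = g x) \<Longrightarrow> refuted (set \<rho>) i (U \<union> W) h"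
  shows "\<exists>\<rho>'. extends \<psi> w (2 ^ card W - 1) \<rho> \<rho>' \<and> refuted (set \<rho>') i U g"
  using assms
proof (induction W arbitrary: U g \<rho>)
  case empty
  then have "refuted (set \<rho>) i U g"
    by simp
  then show ?case
    using extends_refl[OF empty.prems(2)] by auto
next
  case (insert x W)
  let ?U = "insert x U"
  have x: "x \<notin> U" and dis: "?U \<inter> W = {}" and adm: "admissible \<psi> w i (?U \<union> W)"
    using insert.prems(1,3) insert.hyps by auto
  have all: "refuted (set \<rho>) i (?U \<union> W) h"
    if "\<And>z. z \<in> ?U \<Longrightarrow> h z = (g(x := b)) z" for h b
  proof -
    have "h z = g z" if "z \<in> U" for z
      using \<open>\<And>z. z \<in> ?U \<Longrightarrow> h z = (g(x := b)) z\<close>[of z] that x by auto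
    then show ?thesis
      using insert.prems(4)[of h] by simp
  qed
  have "\<exists>\<rho>1. extends \<psi> w (2 ^ card W - 1) \<rho> \<rho>1 \<and> refuted (set \<rho>1) i ?U (g(x := True))"
    by (rule insert.IH[OF dis insert.prems(2) adm]) (rule all)
  then obtain \<rho>1 where 1: "extends \<psi> w (2 ^ card W - 1) \<rho> \<rho>1"
      "refuted (set \<rho>1) i ?U (g(x := True))"
    by blast
  have \<rho>1: "bounded_proof \<psi> w \<rho>1" "set \<rho> \<subseteq> set \<rho>1"
    using 1(1) by (auto simp: extends_def)
  \<comment> \<open>The second branch continues the proof left by the first, so that both
    refutations are available for the final resolution.\<close>
  have "\<exists>\<rho>2. extends \<psi> w (2 ^ card W - 1) \<rho>1 \<rho>2 \<and> refuted (set \<rho>2) i ?U (g(x := False))"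
    by (rule insert.IH[OF dis \<rho>1(1) adm], rule refuted_mono[OF _ \<rho>1(2) order_refl]) (rule all)
  then obtain \<rho>2 where 2: "extends \<psi> w (2 ^ card W - 1) \<rho>1 \<rho>2"
      "refuted (set \<rho>2) i ?U (g(x := False))"
    by blast
  have \<rho>2: "bounded_proof \<psi> w \<rho>2" "set \<rho>1 \<subseteq> set \<rho>2"
    using 2(1) by (auto simp: extends_def)
  obtain \<rho>3 where 3: "extends \<psi> w 1 \<rho>2 \<rho>3" "refuted (set \<rho>3) i U g"
    using refuted_resolve[OF \<rho>2(1) admissible_subset[OF adm] x
        refuted_mono[OF 1(2) \<rho>2(2) order_refl] 2(2)] by blast
  have "extends \<psi> w (2 * (2 ^ card W - 1)) \<rho> \<rho>2"
    using extends_trans[OF 1(1) 2(1)] by simp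
  moreover have "2 * (2 ^ card W - 1) + 1 \<le> 2 ^ card (insert x W) - (1::nat)"
  proof -
    have "(2::nat) ^ card (insert x W) = 2 * 2 ^ card W"
      using insert.hyps by simp
    moreover have "(1::nat) \<le> 2 ^ card W"
      by simp
    ultimately show ?thesis
      by linarith
  qed
  ultimately have "extends \<psi> w (2 ^ card (insert x W) - 1) \<rho> \<rho>3"
    using extends_trans[OF _ 3(1)] by blast
  then show ?case
    using 3(2) by blast
qed

section \<open>Simulating a single constraint step\<close>

text \<open>Total maps are used and compared with \<open>F\<close> through \<open>restrict\<close>,
  so that updated maps and arbitrary extensions can be plugged in directly.\<close>

definition established ::
  "'v clause_judgement set \<Rightarrow> index \<Rightarrow> 'v set \<Rightarrow> ('v \<Rightarrow> bool) set \<Rightarrow> bool" where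
  "established S i V F \<longleftrightarrow>
     (\<forall>g. restrict g V \<notin> F \<longrightarrow> refuted S i V g) \<and> (F = {} \<longrightarrow> (i, {}) \<in> S)"

lemma established_mono: "established S i V F \<Longrightarrow> S \<subseteq> T \<Longrightarrow> established T i V F"
  unfolding established_def using refuted_mono by blast

lemma card_assignments: "finite V \<Longrightarrow> card (V \<rightarrow>\<^sub>E (UNIV :: bool set)) = 2 ^ card V"
  by (simp add: card_PiE)

lemma finite_assignments: "finite V \<Longrightarrow> finite (V \<rightarrow>\<^sub>E (UNIV :: bool set))"
  by (simp add: finite_PiE)

text \<open>If \<open>F\<close> is empty, every map is refuted over \<open>V\<close>, and
  eliminating all of \<open>V\<close> yields the empty clause. Otherwise the demand about the empty
  clause is vacuous and nothing is added.\<close>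

lemma establish_from_refuted:
  assumes "bounded_proof \<psi> w \<rho>" "admissible \<psi> w i V"
    and "\<And>g. restrict g V \<notin> F \<Longrightarrow> refuted (set \<rho>) i V g"
  shows "\<exists>\<rho>'. extends \<psi> w (2 ^ card V - 1) \<rho> \<rho>' \<and> established (set \<rho>') i V F"
proof (cases "F = {}")
  case True
  \<comment> \<open>The map is an arbitrary choice: over the empty variable set, refutation does not
    depend on it.\<close>
  then have "\<exists>\<rho>'. extends \<psi> w (2 ^ card V - 1) \<rho> \<rho>' \<and> refuted (set \<rho>') i {} (\<lambda>_. True)"
    using assms by (intro refuted_project) (auto simp: admissible_def)
  then obtain \<rho>' where \<rho>': "extends \<psi> w (2 ^ card V - 1) \<rho> \<rho>'" "(i, {}) \<in> set \<rho>'"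
    by (auto simp: refuted_empty)
  then have "established (set \<rho>') i V F"
    using refuted_mono[of "set \<rho>'" i "{}" _ "set \<rho>'" V]
    by (auto simp: established_def refuted_empty)
  then show ?thesis
    using \<rho>'(1) by blast
next
  case False
  then show ?thesis
    using assms(3) extends_refl[OF assms(1)] unfolding established_def by blast
qed

text \<open>An empty \<open>F\<close> needs only its empty clause moved; a nonempty \<open>F\<close>
  leaves at most \<open>2 ^ card V - 1\<close> assignments, each needing one moved clause. The outer
  \<open>max\<close> with 1 covers \<open>w = 0\<close>. The assumption \<open>step\<close> covers
  both directions of flow.\<close>

lemma establish_flow:
  assumes \<rho>: "bounded_proof \<psi> w \<rho>" and adm: "admissible \<psi> w i V" and F: "F \<subseteq> V \<rightarrow>\<^sub>E UNIV"
    and est: "established (set \<rho>) j V F"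
    and step: "\<And>S \<alpha>. (j, \<alpha>) \<in> S \<Longrightarrow> clause_step \<psi> S (i, \<alpha>)"
  shows "\<exists>\<rho>'. extends \<psi> w (max (2 ^ w - 1) 1) \<rho> \<rho>' \<and> established (set \<rho>') i V F"
proof (cases "F = {}")
  case True
  then have j: "(j, {}) \<in> set \<rho>"
    using est by (simp add: established_def)
  then have "extends \<psi> w 1 \<rho> (\<rho> @ [(i, {})])"
    using extends_step[OF \<rho> step[OF j] _ adm] by (simp add: is_clause_def vars_def)
  moreover have "established (set (\<rho> @ [(i, {})])) i V F"
    using refuted_mono[of "set (\<rho> @ [(i, {})])" i "{}" _ "set (\<rho> @ [(i, {})])" V]
    by (auto simp: established_def refuted_empty)
  ultimately show ?thesis
    using extends_mono by (metis max.cobounded2)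
next
  case False
  have fin: "finite V" and Vw: "card V \<le> w"
    using adm by (auto simp: admissible_def)
  let ?G = "(V \<rightarrow>\<^sub>E UNIV) - F"
  have "\<exists>\<rho>'. extends \<psi> w (card ?G * 1) \<rho> \<rho>' \<and> (\<forall>g\<in>?G. refuted (set \<rho>') i V g)"
  proof (rule extends_all[OF _ \<rho>])
    fix g \<rho>'
    assume g: "g \<in> ?G" and \<rho>': "bounded_proof \<psi> w \<rho>'" "set \<rho> \<subseteq> set \<rho>'"
    then have "restrict g V \<notin> F"
      by auto
    then obtain \<alpha> where \<alpha>: "(j, \<alpha>) \<in> set \<rho>'" "vars \<alpha> \<subseteq> V" "\<not> satisfies g \<alpha>"
      using est \<rho>'(2) unfolding established_def refuted_def by blast
    then have "extends \<psi> w 1 \<rho>' (\<rho>' @ [(i, \<alpha>)])"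
      using extends_step[OF \<rho>'(1) step[OF \<alpha>(1)] bounded_proof_clause[OF \<rho>'(1) \<alpha>(1)] adm] by blast
    moreover have "refuted (set (\<rho>' @ [(i, \<alpha>)])) i V g"
      using \<alpha> by (auto simp: refuted_def)
    ultimately show "\<exists>\<rho>''. extends \<psi> w 1 \<rho>' \<rho>'' \<and> refuted (set \<rho>'') i V g"
      by blast
  qed (use finite_assignments[OF fin] in auto)
  then obtain \<rho>' where \<rho>': "extends \<psi> w (card ?G) \<rho> \<rho>'" "\<forall>g\<in>?G. refuted (set \<rho>') i V g"
    by auto
  have "refuted (set \<rho>') i V g" if "restrict g V \<notin> F" for g
    using refuted_if_restrict_refuted[OF \<rho>'(2) that] .
  then have "established (set \<rho>') i V F"
    using False by (auto simp: established_def)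
  moreover have "card ?G \<le> max (2 ^ w - 1) 1"
  proof -
    \<comment> \<open>This member of \<open>F\<close> saves the one clause that separates
      \<open>2 ^ w\<close> from the bound.\<close>
    have "card F \<ge> 1"
      using False F finite_subset[OF F finite_assignments[OF fin]] by (simp add: Suc_le_eq card_gt_0_iff)
    moreover have "card ?G = 2 ^ card V - card F"
      using F finite_subset[OF F finite_assignments[OF fin]]
      by (simp add: card_Diff_subset card_assignments[OF fin])
    moreover have "2 ^ card V \<le> (2::nat) ^ w"
      using Vw by simp
    ultimately show ?thesis
      by linarith
  qed
  ultimately show ?thesis
    using \<rho>'(1) extends_mono by blast
qed

text \<open>If \<open>g\<close> lies outside the projection, every extension of \<open>g\<close> to
  \<open>V\<close> lies outside \<open>F\<close>, so resolving away \<open>V - U\<close> refutes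
  \<open>g\<close> over \<open>U\<close>. There are at most \<open>2 ^ card U\<close> such maps, and
  the total is at most \<open>2 ^ card V - 2 ^ card U\<close>.\<close>

lemma establish_projection:
  assumes \<rho>: "bounded_proof \<psi> w \<rho>" and adm: "admissible \<psi> w i V" and U: "U \<subseteq> V"
    and est: "established (set \<rho>) i V F"
  shows "\<exists>\<rho>'. extends \<psi> w (2 ^ w - 1) \<rho> \<rho>' \<and> established (set \<rho>') i U (proj U F)"
proof -
  have fin: "finite V" and Vw: "card V \<le> w"
    using adm by (auto simp: admissible_def)
  have finU: "finite U"
    using fin U finite_subset by blast
  let ?G = "(U \<rightarrow>\<^sub>E UNIV) - proj U F"
  let ?n = "2 ^ card (V - U) - (1::nat)"
  have "\<exists>\<rho>'. extends \<psi> w (card ?G * ?n) \<rho> \<rho>' \<and> (\<forall>g\<in>?G. refuted (set \<rho>') i U g)"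
  proof (rule extends_all[OF _ \<rho>])
    fix g \<rho>'
    assume g: "g \<in> ?G" and \<rho>': "bounded_proof \<psi> w \<rho>'" "set \<rho> \<subseteq> set \<rho>'"
    have UV: "U \<union> (V - U) = V"
      using U by auto
    show "\<exists>\<rho>''. extends \<psi> w ?n \<rho>' \<rho>'' \<and> refuted (set \<rho>'') i U g"
    proof (rule refuted_project)
      fix h
      assume h: "\<And>x. x \<in> U \<Longrightarrow> h x = g x"
      have "restrict (restrict h V) U = g"
        using g h U by (intro ext) (auto simp: restrict_def PiE_def extensional_def)
      then have "restrict h V \<notin> F"
        using g unfolding proj_def by blast
      then have "refuted (set \<rho>) i V h"
        using est by (simp add: established_def)
      then show "refuted (set \<rho>') i (U \<union> (V - U)) h"
        using refuted_mono \<rho>'(2) UV by blast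
    qed (use fin adm \<rho>' UV in auto)
  qed (use finite_assignments[OF finU] in auto)
  then obtain \<rho>' where \<rho>': "extends \<psi> w (card ?G * ?n) \<rho> \<rho>'" "\<forall>g\<in>?G. refuted (set \<rho>') i U g"
    by auto
  have "refuted (set \<rho>') i U g" if "restrict g U \<notin> proj U F" for g
    using refuted_if_restrict_refuted[OF \<rho>'(2) that] .
  \<comment> \<open>A projection is empty only if \<open>F\<close> is, and then the empty clause is
    already present at \<open>i\<close>.\<close>
  moreover have "(i, {}) \<in> set \<rho>'" if "proj U F = {}"
    using that est \<rho>'(1) by (auto simp: proj_def established_def extends_def)
  ultimately have "established (set \<rho>') i U (proj U F)"
    by (auto simp: established_def)
  moreover have "card ?G * ?n \<le> 2 ^ w - 1"
  proof -
    have "card ?G \<le> 2 ^ card U"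
      using card_mono[OF finite_assignments[OF finU], of ?G] card_assignments[OF finU] by auto
    then have "card ?G * ?n \<le> 2 ^ card U * ?n"
      by simp
    also have "\<dots> = 2 ^ (card U + card (V - U)) - 2 ^ card U"
      by (simp add: power_add diff_mult_distrib2)
    also have "card U + card (V - U) = card V"
      using U fin finU by (simp add: card_Diff_subset card_mono)
    also have "2 ^ card V - 2 ^ card U \<le> 2 ^ card V - (1::nat)"
      by (rule diff_le_mono2) simp
    also have "\<dots> \<le> 2 ^ w - 1"
      using Vw by (intro diff_le_mono) simp
    finally show ?thesis .
  qed
  ultimately show ?thesis
    using \<rho>'(1) extends_mono by blast
qed

text \<open>A map outside the join fails on \<open>U1\<close> or on \<open>U2\<close>, and the
  clause refuting it there serves over the union. New clauses are spent only on deriving the empty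
  clause when the join is empty.\<close>

lemma establish_join:
  assumes \<rho>: "bounded_proof \<psi> w \<rho>" and adm: "admissible \<psi> w i (U1 \<union> U2)"
    and est: "established (set \<rho>) i U1 F1" "established (set \<rho>) i U2 F2"
  shows "\<exists>\<rho>'. extends \<psi> w (2 ^ w - 1) \<rho> \<rho>' \<and>
    established (set \<rho>') i (U1 \<union> U2) (join UNIV U1 F1 U2 F2)"
proof -
  have "refuted (set \<rho>) i (U1 \<union> U2) g"
    if "restrict g (U1 \<union> U2) \<notin> join UNIV U1 F1 U2 F2" for g
  proof -
    have "restrict (restrict g (U1 \<union> U2)) U1 = restrict g U1"
      "restrict (restrict g (U1 \<union> U2)) U2 = restrict g U2"
      by (auto simp: restrict_def)
    then have "restrict g U1 \<notin> F1 \<or> restrict g U2 \<notin> F2"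
      using that by (auto simp: join_def)
    then have "refuted (set \<rho>) i U1 g \<or> refuted (set \<rho>) i U2 g"
      using est by (auto simp: established_def)
    then show ?thesis
      using refuted_mono[of "set \<rho>" i _ g "set \<rho>" "U1 \<union> U2"] by blast
  qed
  then obtain \<rho>' where \<rho>': "extends \<psi> w (2 ^ card (U1 \<union> U2) - 1) \<rho> \<rho>'"
      "established (set \<rho>') i (U1 \<union> U2) (join UNIV U1 F1 U2 F2)"
    using establish_from_refuted[OF \<rho> adm] by blast
  moreover have "2 ^ card (U1 \<union> U2) - 1 \<le> 2 ^ w - (1::nat)"
    using adm by (intro diff_le_mono) (auto simp: admissible_def)
  ultimately show ?thesis
    using extends_mono by blast
qed

text \<open>For \<open>g\<close> outside the eliminated set some value \<open>b\<close> puts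
  \<open>g(y := b)\<close> outside \<open>F\<close>; deleting the literals on \<open>y\<close> from
  its refuting clause leaves a clause falsified by \<open>g\<close>.\<close>

lemma establish_forall_elim:
  assumes \<rho>: "bounded_proof \<psi> w \<rho>" and adm: "admissible \<psi> w i (V - {y})"
    and V: "finite V" "card V \<le> w" "y \<in> V"
    and est: "established (set \<rho>) j V F"
    and step: "\<And>S \<alpha>. (j, \<alpha>) \<in> S \<Longrightarrow> clause_step \<psi> S (i, \<alpha> - {Pos y, Neg y})"
  shows "\<exists>\<rho>'. extends \<psi> w (2 ^ w - 1) \<rho> \<rho>' \<and>
    established (set \<rho>') i (V - {y}) (forall_elim UNIV V y F)"
proof -
  let ?U = "V - {y}" and ?E = "forall_elim UNIV V y F"
  have finU: "finite ?U"
    using V by simp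
  let ?G = "(?U \<rightarrow>\<^sub>E UNIV) - ?E"
  have "\<exists>\<rho>'. extends \<psi> w (card ?G * 1) \<rho> \<rho>' \<and> (\<forall>g\<in>?G. refuted (set \<rho>') i ?U g)"
  proof (rule extends_all[OF _ \<rho>])
    fix g \<rho>'
    assume g: "g \<in> ?G" and \<rho>': "bounded_proof \<psi> w \<rho>'" "set \<rho> \<subseteq> set \<rho>'"
    then obtain b where "g(y := b) \<notin> F"
      by (auto simp: forall_elim_def)
    moreover have "restrict (g(y := b)) V = g(y := b)"
      using g V(3) by (intro ext) (auto simp: restrict_def PiE_def extensional_def)
    ultimately have "refuted (set \<rho>) j V (g(y := b))"
      using est by (simp add: established_def)
    then obtain \<alpha> where \<alpha>: "(j, \<alpha>) \<in> set \<rho>'" "vars \<alpha> \<subseteq> V" "\<not> satisfies (g(y := b)) \<alpha>"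
      using \<rho>'(2) by (auto simp: refuted_def)
    let ?\<beta> = "\<alpha> - {Pos y, Neg y}"
    have "var L \<in> ?U \<and> \<not> lit_true g L" if L: "L \<in> ?\<beta>" for L
    proof -
      have "var L \<noteq> y"
        using L by (cases L) auto
      moreover have "var L \<in> V"
        using L \<alpha>(2) by (auto simp: vars_def)
      ultimately show ?thesis
        using not_lit_true_if_falsified_update[OF \<alpha>(3)] L by blast
    qed
    then have \<beta>: "vars ?\<beta> \<subseteq> ?U" "\<not> satisfies g ?\<beta>"
      by (auto simp: vars_def satisfies_def)
    have "is_clause ?\<beta>"
      using bounded_proof_clause[OF \<rho>'(1) \<alpha>(1)] by (auto simp: is_clause_def)
    then have "extends \<psi> w 1 \<rho>' (\<rho>' @ [(i, ?\<beta>)])"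
      by (intro extends_step[OF \<rho>'(1) step[OF \<alpha>(1)] _ adm \<beta>(1)])
    moreover have "refuted (set (\<rho>' @ [(i, ?\<beta>)])) i ?U g"
      using \<beta> unfolding refuted_def by (intro exI[of _ ?\<beta>]) simp
    ultimately show "\<exists>\<rho>''. extends \<psi> w 1 \<rho>' \<rho>'' \<and> refuted (set \<rho>'') i ?U g"
      by blast
  qed (use finite_assignments[OF finU] in auto)
  then obtain \<rho>' where \<rho>': "extends \<psi> w (card ?G) \<rho> \<rho>'" "\<forall>g\<in>?G. refuted (set \<rho>') i ?U g"
    by auto
  have ref: "refuted (set \<rho>') i ?U g" if "restrict g ?U \<notin> ?E" for g
    using refuted_if_restrict_refuted[OF \<rho>'(2) that] .
  have "bounded_proof \<psi> w \<rho>'"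
    using \<rho>'(1) by (simp add: extends_def)
  \<comment> \<open>The eliminated set may be empty although \<open>F\<close> is not, so the empty
    clause may have to be derived afresh.\<close>
  then obtain \<rho>'' where \<rho>'': "extends \<psi> w (2 ^ card ?U - 1) \<rho>' \<rho>''" "established (set \<rho>'') i ?U ?E"
    using establish_from_refuted[OF _ adm ref] by blast
  moreover have "card ?G + (2 ^ card ?U - 1) \<le> 2 ^ w - 1"
  proof -
    have "card ?G \<le> 2 ^ card ?U"
      using card_mono[OF finite_assignments[OF finU], of ?G] card_assignments[OF finU] by auto
    \<comment> \<open>Removals and resolutions are both counted over \<open>V - {y}\<close>; the
      missing variable pays for doing both.\<close>
    moreover have "(2::nat) * 2 ^ card ?U = 2 ^ card V"
      using V by (metis card_Suc_Diff1 power_Suc)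
    moreover have "(2::nat) ^ card V \<le> 2 ^ w"
      using V by simp
    moreover have "(1::nat) \<le> 2 ^ card ?U"
      by simp
    ultimately show ?thesis
      by linarith
  qed
  ultimately show ?thesis
    using extends_trans[OF \<rho>'(1)] by blast
qed

text \<open>The clause itself refutes every map outside the relation. As a nonempty clause is
  satisfiable, the relation is empty only for the empty clause.\<close>

lemma establish_atom:
  assumes \<rho>: "bounded_proof \<psi> w \<rho>" and adm: "admissible \<psi> w i (set vs)"
    and leaf: "subformula \<psi> i = Some (Leaf \<gamma>)" and cl: "is_clause \<gamma>"
    and tr: "translates_clause B \<gamma> (Atom R vs)"
  shows "\<exists>\<rho>'. extends \<psi> w 1 \<rho> \<rho>' \<and>
    established (set \<rho>') i (set vs) {f \<in> set vs \<rightarrow>\<^sub>E UNIV. map f vs \<in> interp B R}"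
    (is "\<exists>\<rho>'. _ \<and> established _ _ _ ?F")
proof -
  have vs: "set vs = vars \<gamma>"
    using tr by (simp add: translates_clause_def)
  have sat: "restrict g (set vs) \<in> ?F" if "satisfies g \<gamma>" for g
  proof -
    have "satisfies (restrict g (vars \<gamma>)) \<gamma>"
      using that satisfies_cong[of \<gamma> "vars \<gamma>" g "restrict g (vars \<gamma>)"] by simp
    moreover have "restrict g (vars \<gamma>) \<in> vars \<gamma> \<rightarrow>\<^sub>E {False, True}"
      by auto
    ultimately have "map (restrict g (vars \<gamma>)) vs \<in> interp B R"
      using tr unfolding translates_clause_def atom.sel by blast
    then show ?thesis
      using vs by auto
  qed
  have "\<gamma> = {}" if "?F = {}"
  proof (rule ccontr)
    assume "\<gamma> \<noteq> {}"
    then obtain L where "L \<in> \<gamma>"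
      by blast
    \<comment> \<open>This map makes \<open>L\<close> true: it is true only at the variable of a
      positive \<open>L\<close>, and false everywhere for a negative one.\<close>
    then have "satisfies (\<lambda>v. L = Pos v) \<gamma>"
      unfolding satisfies_def by (intro bexI[of _ L]) (cases L; simp)
    then show False
      using sat that by blast
  qed
  then have "established (set (\<rho> @ [(i, \<gamma>)])) i (set vs) ?F"
    using sat vs unfolding established_def refuted_def by auto
  moreover have "extends \<psi> w 1 \<rho> (\<rho> @ [(i, \<gamma>)])"
    using extends_step[OF \<rho> clause_step.clause[OF leaf] cl adm] vs by blast
  ultimately show ?thesis
    by blast
qed

lemma establish_constraint_step:
  assumes \<psi>: "qcbf_instance \<psi>" and tr: "qcsp_translation \<psi> \<phi> B"
    and \<rho>: "bounded_proof \<psi> w \<rho>"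
    and P: "\<And>i V F. (i, V, F) \<in> P \<Longrightarrow>
      established (set \<rho>) i V F \<and> is_constraint_judgement \<phi> B (i, V, F) \<and> card V \<le> w"
    and step: "constraint_step \<phi> B P (i, V, F)"
    and J: "is_constraint_judgement \<phi> B (i, V, F)" "card V \<le> w"
  shows "\<exists>\<rho>'. extends \<psi> w (max (2 ^ w - 1) 1) \<rho> \<rho>' \<and> established (set \<rho>') i V F"
proof -
  have rel: "rel_qconj (translates_clause B) (=) \<psi> \<phi>" and univ: "universe B = UNIV"
    using tr by (auto simp: qcsp_translation_def)
  \<comment> \<open>The two formulas share indices and free variables, so judgements about
    \<open>\<phi>\<close> give admissible variable sets for \<open>\<psi>\<close>.\<close>
  have adm: "admissible \<psi> w i V \<and> F \<subseteq> V \<rightarrow>\<^sub>E UNIV"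
    if cj: "is_constraint_judgement \<phi> B (i, V, F)" "card V \<le> w" for i V F
  proof -
    obtain q where q: "subformula \<phi> i = Some q" "V \<subseteq> free atom_vars q" "F \<subseteq> V \<rightarrow>\<^sub>E UNIV"
      using cj univ by (auto simp: is_constraint_judgement_def)
    obtain p where p: "subformula \<psi> i = Some p" "free vars p = free atom_vars q"
      using translation_subformula[OF rel q(1)] translation_free by blast
    show ?thesis
      using q p cj finite_subset[OF q(2) finite_free_atom_vars] by (auto simp: admissible_def)
  qed
  note J = adm[OF J]
  have P: "established (set \<rho>) i V F" "admissible \<psi> w i V" "F \<subseteq> V \<rightarrow>\<^sub>E UNIV"
    if "(i, V, F) \<in> P" for i V F
    using P[OF that] adm[of i V F] by simp_all
  have le: "2 ^ w - 1 \<le> max (2 ^ w - 1) (1::nat)" "1 \<le> max (2 ^ w - 1) (1::nat)"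
    by simp_all
  show ?thesis
    using step
  proof cases
    case (atom R vs)
    obtain p where p: "subformula \<psi> i = Some p"
        "rel_qconj (translates_clause B) (=) p (Leaf (Atom R vs))"
      using translation_subformula[OF rel atom(3)] by blast
    then obtain \<gamma> where \<gamma>: "p = Leaf \<gamma>" "translates_clause B \<gamma> (Atom R vs)"
      by (cases p) auto
    then have "is_clause \<gamma>"
      using \<psi> p by (auto simp: qcbf_instance_def)
    moreover have "admissible \<psi> w i (set vs)"
      using J atom(1) by simp
    ultimately have "\<exists>\<rho>'. extends \<psi> w 1 \<rho> \<rho>' \<and> established (set \<rho>') i V F"
      using establish_atom[OF \<rho> _ p(1)[unfolded \<gamma>(1)] _ \<gamma>(2)] unfolding atom(1,2) univ
      by blast
    then show ?thesis
      using extends_mono[OF _ le(2)] by blast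
  next
    case (projection V' F')
    have "\<exists>\<rho>'. extends \<psi> w (2 ^ w - 1) \<rho> \<rho>' \<and> established (set \<rho>') i V F"
      unfolding projection(1)
      using projection(2,3) P by (intro establish_projection[OF \<rho>]) blast+
    then show ?thesis
      using extends_mono[OF _ le(1)] by blast
  next
    case (join U1 F1 U2 F2)
    have "admissible \<psi> w i (U1 \<union> U2)"
      using J join(1) by simp
    then have "\<exists>\<rho>'. extends \<psi> w (2 ^ w - 1) \<rho> \<rho>' \<and> established (set \<rho>') i V F"
      using establish_join[OF \<rho> _ P(1)[OF join(3)] P(1)[OF join(4)]] unfolding join(1,2) univ
      by blast
    then show ?thesis
      using extends_mono[OF _ le(1)] by blast
  next
    case (upward_flow j)
    then have "\<And>S \<alpha>. (j, \<alpha>) \<in> S \<Longrightarrow> clause_step \<psi> S (i, \<alpha>)"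
      using clause_step.upward_flow translation_parent[OF rel] by blast
    then show ?thesis
      using establish_flow[OF \<rho> _ _ P(1)[OF upward_flow(1)]] J by blast
  next
    case (forall_elimination j V' F' y q)
    obtain p where p: "subformula \<psi> i = Some p"
        "rel_qconj (translates_clause B) (=) p (Forall y q)"
      using translation_subformula[OF rel forall_elimination(7)] by blast
    then obtain p' where p': "p = Forall y p'"
      by (cases p) auto
    have par: "parent \<psi> i j"
      using forall_elimination(5) translation_parent[OF rel] by blast
    have sub: "subformula \<psi> j = Some p'"
    proof -
      obtain n where n: "j = i @ [n]" "subformula \<psi> j \<noteq> None"
        using par by (auto simp: parent_def indices_def)
      \<comment> \<open>A universal quantification has a single child, so an existing index one step
        below it must carry the quantified formula; the induction descends along
        \<open>i\<close>.\<close>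
      have "subformula r (i @ [n]) = Some p'"
        if "subformula r i = Some (Forall y p')" "subformula r (i @ [n]) \<noteq> None" for r :: "'a qcbf"
        using that by (induction i arbitrary: r) (auto split: if_splits)
      then show ?thesis
        using n p p' by blast
    qed
    have "clause_step \<psi> S (i, \<alpha> - {Pos y, Neg y})" if "(j, \<alpha>) \<in> S" for S \<alpha>
      using clause_step.forall_removal[OF that par sub] p(1) p' by simp
    then have "\<exists>\<rho>'. extends \<psi> w (2 ^ w - 1) \<rho> \<rho>' \<and>
        established (set \<rho>') i (V' - {y}) (forall_elim UNIV V' y F')"
      using J forall_elimination(1,4) P(1,2)[OF forall_elimination(3)]
      by (intro establish_forall_elim[OF \<rho>, of i V' y j F']) (simp_all add: admissible_def)
    then show ?thesis
      unfolding forall_elimination(1,2) univ using extends_mono[OF _ le(1)] by blast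
  next
    case (downward_flow i')
    then have "\<And>S \<alpha>. (i', \<alpha>) \<in> S \<Longrightarrow> clause_step \<psi> S (i, \<alpha>)"
      using clause_step.downward_flow translation_parent[OF rel] by blast
    then show ?thesis
      using establish_flow[OF \<rho> _ _ P(1)[OF downward_flow(1)]] J by blast
  qed
qed

section \<open>Induction along the constraint proof and the length bound\<close>

lemma simulate_constraint_proof:
  assumes "qcbf_instance \<psi>" "qcsp_translation \<psi> \<phi> B"
    and "constraint_judgement_proof \<phi> B \<pi>" "\<And>i V F. (i, V, F) \<in> set \<pi> \<Longrightarrow> card V \<le> w"
  shows "\<exists>\<rho>. bounded_proof \<psi> w \<rho> \<and> length \<rho> \<le> length \<pi> * max (2 ^ w - 1) 1 \<and>
    (\<forall>(i, V, F)\<in>set \<pi>. established (set \<rho>) i V F)"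
  using assms(3,4)
proof (induction \<pi> rule: rev_induct)
  case Nil
  show ?case
    by (intro exI[of _ "[]"]) (simp add: bounded_proof_def clause_judgement_proof_def)
next
  case (snoc J \<pi>)
  obtain i V F where J: "J = (i, V, F)"
    by (cases J)
  have pi: "is_constraint_judgement \<phi> B ((\<pi> @ [J]) ! k)"
      "constraint_step \<phi> B (set (take k (\<pi> @ [J]))) ((\<pi> @ [J]) ! k)" if "k < Suc (length \<pi>)" for k
    using snoc.prems(1) that by (auto simp: constraint_judgement_proof_def)
  have "constraint_judgement_proof \<phi> B \<pi>"
    unfolding constraint_judgement_proof_def
  proof (intro allI impI)
    fix k assume "k < length \<pi>"
    then show "is_constraint_judgement \<phi> B (\<pi> ! k) \<and> constraint_step \<phi> B (set (take k \<pi>)) (\<pi> ! k)"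
      using pi[of k] by (simp add: nth_append)
  qed
  moreover have "card V \<le> w" if "(i, V, F) \<in> set \<pi>" for i V F
    using snoc.prems(2) that by auto
  ultimately obtain \<rho> where \<rho>: "bounded_proof \<psi> w \<rho>"
      "length \<rho> \<le> length \<pi> * max (2 ^ w - 1) 1"
      "\<forall>(i, V, F)\<in>set \<pi>. established (set \<rho>) i V F"
    using snoc.IH by blast
  have "\<exists>\<rho>'. extends \<psi> w (max (2 ^ w - 1) 1) \<rho> \<rho>' \<and> established (set \<rho>') i V F"
  proof (rule establish_constraint_step[OF assms(1,2) \<rho>(1)])
    fix i V F
    assume mem: "(i, V, F) \<in> set \<pi>"
    then obtain k where "k < length \<pi>" "\<pi> ! k = (i, V, F)"
      by (auto simp: in_set_conv_nth)
    then show "established (set \<rho>) i V F \<and> is_constraint_judgement \<phi> B (i, V, F) \<and> card V \<le> w"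
      using mem \<rho>(3) pi(1)[of k] snoc.prems(2)[of i V F] by (auto simp: nth_append)
  qed (use pi[of "length \<pi>"] snoc.prems(2)[of i V F] J in auto)
  then obtain \<rho>' where \<rho>': "extends \<psi> w (max (2 ^ w - 1) 1) \<rho> \<rho>'" "established (set \<rho>') i V F"
    by blast
  have "length \<rho>' \<le> length (\<pi> @ [J]) * max (2 ^ w - 1) 1"
    using \<rho>(2) \<rho>'(1) by (simp add: extends_def)
  moreover have "\<forall>(i, V, F)\<in>set (\<pi> @ [J]). established (set \<rho>') i V F"
  proof -
    \<comment> \<open>Earlier judgements stay established because the clause proof only gains
      judgements.\<close>
    have "established (set \<rho>') i V F" if "(i, V, F) \<in> set \<pi>" for i V F
      using \<rho>(3) \<rho>'(1) that by (auto simp: extends_def intro: established_mono)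
    then show ?thesis
      using \<rho>'(2) J by auto
  qed
  ultimately show ?case
    using \<rho>'(1) by (auto simp: extends_def)
qed

text \<open>For \<open>w\<close> at most 1 both sides equal 1. From 2 on, \<open>2 ^ w\<close> is
  twice \<open>2 ^ (w - 1)\<close> and the factor 2 is at most \<open>w\<close>.\<close>

lemma simulation_cost_le: "max (2 ^ w - 1) 1 \<le> max (w * 2 ^ (w - 1)) (1::nat)"
proof (cases "w \<le> 1")
  case True
  then have "w = 0 \<or> w = 1"
    by linarith
  then show ?thesis
    by auto
next
  case False
  then have "(2::nat) ^ w = 2 * 2 ^ (w - 1)"
    by (cases w) auto
  also have "\<dots> \<le> w * 2 ^ (w - 1)"
    using False by (intro mult_right_mono) auto
  finally show ?thesis
    by linarith
qed

theorem theoremA2: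
  fixes \<psi> :: "'v qcbf"
    and \<phi> :: "('r, 'v) qc_formula"
    and B :: "('r, bool) relstruct"
    and \<pi> :: "('v, bool) constraint_judgement list"
    and s w :: nat
  assumes "qcbf_instance \<psi>"
    and "qcsp_translation \<psi> \<phi> B"
    and "constraint_judgement_proof \<phi> B \<pi>"
    and "length \<pi> = s"
    and "constraint_proof_width \<pi> = w"
  shows "\<exists>\<rho>. clause_judgement_proof \<psi> \<rho>
    \<and> length \<rho> \<le> s * max (w * 2 ^ (w - 1)) 1
    \<and> clause_proof_width \<rho> \<le> w
    \<and> (\<forall>i V F g. (i, V, F) \<in> set \<pi> \<longrightarrow> g \<in> V \<rightarrow>\<^sub>E {False, True} \<longrightarrow> g \<notin> F \<longrightarrow>
          (\<exists>\<alpha>. (i, \<alpha>) \<in> set \<rho> \<and> vars \<alpha> \<subseteq> V \<and> \<not> satisfies g \<alpha>))"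
proof -
  have "card V \<le> w" if "(i, V, F) \<in> set \<pi>" for i V F
    unfolding assms(5)[symmetric] constraint_proof_width_def using that
    by (intro Max_ge) (auto intro: rev_image_eqI)
  then obtain \<rho> where \<rho>: "bounded_proof \<psi> w \<rho>" "length \<rho> \<le> length \<pi> * max (2 ^ w - 1) 1"
      "\<forall>(i, V, F)\<in>set \<pi>. established (set \<rho>) i V F"
    using simulate_constraint_proof[OF assms(1-3)] by blast
  have "length \<rho> \<le> s * max (w * 2 ^ (w - 1)) 1"
    using \<rho>(2) mult_le_mono2[OF simulation_cost_le, of "length \<pi>"] assms(4) by (metis order_trans)
  moreover have "clause_proof_width \<rho> \<le> w"
    using \<rho>(1) by (auto simp: clause_proof_width_def bounded_proof_def)
  moreover have "\<exists>\<alpha>. (i, \<alpha>) \<in> set \<rho> \<and> vars \<alpha> \<subseteq> V \<and> \<not> satisfies g \<alpha>"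
    if "(i, V, F) \<in> set \<pi>" "g \<in> V \<rightarrow>\<^sub>E {False, True}" "g \<notin> F" for i V F g
  proof -
    \<comment> \<open>Extensionality of \<open>g\<close> turns \<open>g\<close> lying outside
      \<open>F\<close> into the form required by \<open>established\<close>.\<close>
    have "restrict g V = g"
      using that(2) by (rule PiE_restrict)
    then show ?thesis
      using \<rho>(3) that by (fastforce simp: established_def refuted_def)
  qed
  ultimately show ?thesis
    using \<rho>(1) unfolding bounded_proof_def by blast
qed

end
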